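(* There exists a positive constant $c$ such that for all sufficiently large positive integers $r$, \[ G(r) > 2^{c (\log r)^{5/2}/\sqrt{\log \log r}}. \]
   Context: All logarithms are base 2. For positive integers $m,n$, the grid graph $\Gamma_{m,n}$ is the graph on vertex set $[m]\times[n]$ in which distinct vertices $(i,j),(i',j')$ are adjacent iff $i=i'$ or $j=j'$ (i.e. the Cartesian product $K_m\times K_n$). A rectangle is the induced subgraph on $\{(i,j),(i',j),(i,j'),(i',j')\}$ with $i<i'$, $j<j'$. In an edge coloring, a rectangle is alternating if the edges $\{(i,j),(i',j)\}$ and $\{(i,j'),(i',j')\}$ have the same color and the edges $\{(i,j),(i,j')\}$ and $\{(i',j),(i',j')\}$ have the same color. $G(r)$ is the minimum integer $n$ such that every edge coloring of $\Gamma_{n,n}$ with $r$ colors contains an alternating rectangle. *)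

theory Defs
  imports "HOL-Analysis.Analysis"
begin

definition grid_edge :: "nat \<Rightarrow> nat \<times> nat \<Rightarrow> nat \<times> nat \<Rightarrow> bool" where
  "grid_edge n u v \<longleftrightarrow> u \<in> {1..n} \<times> {1..n} \<and> v \<in> {1..n} \<times> {1..n} \<and> u \<noteq> v \<and>
      (fst u = fst v \<or> snd u = snd v)"

definition edge_coloring :: "nat \<Rightarrow> nat \<Rightarrow> (nat \<times> nat \<Rightarrow> nat \<times> nat \<Rightarrow> nat) \<Rightarrow> bool" where
  "edge_coloring n r col \<longleftrightarrow>
     (\<forall>u v. grid_edge n u v \<longrightarrow> col u v = col v u \<and> col u v < r)"

definition has_alternating_rectangle :: "nat \<Rightarrow> (nat \<times> nat \<Rightarrow> nat \<times> nat \<Rightarrow> nat) \<Rightarrow> bool" where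
  "has_alternating_rectangle n col \<longleftrightarrow>
     (\<exists>i i' j j'. 1 \<le> i \<and> i < i' \<and> i' \<le> n \<and> 1 \<le> j \<and> j < j' \<and> j' \<le> n \<and>
        col (i, j) (i', j) = col (i, j') (i', j') \<and>
        col (i, j) (i, j') = col (i', j) (i', j'))"

definition G :: "nat \<Rightarrow> nat" where
  "G r = (LEAST n. \<forall>col. edge_coloring n r col \<longrightarrow> has_alternating_rectangle n col)"

end

theory Submission
  imports Defs "HOL-Real_Asymp.Real_Asymp"
begin

text \<open>
  Index the columns by the vertices of a complete graph whose edges carry an auxiliary colouring
  \<open>c\<close>, and let row \<open>i\<close> use the colouring \<open>p\<^sub>i \<circ> c\<close>, where the \<open>p\<^sub>i\<close> are the words of a code: two of
  them agree on fewer than \<open>s\<close> colours. There is no alternating rectangle iff, for any two rows, the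
  colours between them properly colour the graph formed by the classes of \<open>c\<close> on which
  \<open>p\<^sub>i\<close> and \<open>p\<^sub>i\<^sub>'\<close> agree. So it suffices that every union of fewer than \<open>s\<close> classes of \<open>c\<close> has
  chromatic number at most \<open>r\<close>.

  For vectors \<open>v\<close>, \<open>w\<close>, Mubayi's colouring records the set of differing coordinates and the two
  values at the first of them. Given a family of classes, if some leading coordinate \<open>i\<close> differs in
  at least \<open>B\<close> of them, splitting the vertices by \<open>v i = x\<close> destroys \<open>B\<close> classes on one side and one
  on the other. Otherwise the classes fall into \<open>2 B\<close> groups such that an edge of a class changes
  exactly one of the indicators \<open>v i = x\<close> belonging to its group, and the parities of the groups are
  a proper colouring. Hence \<open>p\<close> classes have chromatic number at most \<open>4\<^sup>B \<gamma>\<^sup>p\<close> with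
  \<open>\<gamma>\<^sup>B \<ge> 1 + \<gamma>\<^sup>B\<^sup>-\<^sup>1\<close>. Taking \<open>t\<close>-tuples of such vectors multiplies these bounds; balancing \<open>t\<close>,
  \<open>B\<close> and \<open>s\<close> gives the exponent \<open>5/2\<close>.
\<close>

section \<open>Chromatic number of unions of colour classes\<close>

text \<open>In-degrees and out-degrees have the same sum, so some vertex \<open>l\<close> has
  in-degree at most \<open>d\<close>, hence at most \<open>2 * d\<close> neighbours in all. The rest
  is coloured by induction, and a colour is left over for \<open>l\<close>.\<close>

lemma degenerate_coloring:
  fixes E :: "'a \<Rightarrow> 'a \<Rightarrow> bool"
  assumes "finite S" and "\<forall>k\<in>S. card {l \<in> S. l \<noteq> k \<and> E k l} \<le> d"
  shows "\<exists>g::'a \<Rightarrow> nat. (\<forall>k\<in>S. g k < 2 * d + 1) \<and>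
           (\<forall>k\<in>S. \<forall>l\<in>S. k \<noteq> l \<longrightarrow> E k l \<longrightarrow> g k \<noteq> g l)"
  using assms
proof (induction S rule: finite_psubset_induct)
  case (psubset S)
  show ?case
  proof (cases "S = {}")
    case True
    then show ?thesis by simp
  next
    case False
    have deg: "card {l \<in> S. l \<noteq> k \<and> P l} = (\<Sum>l\<in>S. if l \<noteq> k \<and> P l then 1 else 0)" for k P
      using psubset.hyps(1) by (simp add: sum.If_cases Int_def)
    have "(\<Sum>l\<in>S. card {k \<in> S. k \<noteq> l \<and> E k l}) = (\<Sum>k\<in>S. card {l \<in> S. l \<noteq> k \<and> E k l})"
      unfolding deg by (subst sum.swap) (auto intro!: sum.cong)
    also have "\<dots> \<le> (\<Sum>k\<in>S. d)"
      using psubset.prems by (intro sum_mono) blast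
    finally have le: "(\<Sum>l\<in>S. card {k \<in> S. k \<noteq> l \<and> E k l}) \<le> (\<Sum>l\<in>S. d)" .
    obtain l where l: "l \<in> S" "card {k \<in> S. k \<noteq> l \<and> E k l} \<le> d"
    proof (rule ccontr)
      assume "\<not> thesis"
      then have "\<forall>l\<in>S. d < card {k \<in> S. k \<noteq> l \<and> E k l}"
        using that by (meson not_le)
      then have "(\<Sum>l\<in>S. d) < (\<Sum>l\<in>S. card {k \<in> S. k \<noteq> l \<and> E k l})"
        using False psubset.hyps(1) by (intro sum_strict_mono) auto
      with le show False by simp
    qed
    have prem: "\<forall>k\<in>S - {l}. card {k' \<in> S - {l}. k' \<noteq> k \<and> E k k'} \<le> d"
    proof
      fix k assume "k \<in> S - {l}"
      have "card {k' \<in> S - {l}. k' \<noteq> k \<and> E k k'} \<le> card {k' \<in> S. k' \<noteq> k \<and> E k k'}"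
        using psubset.hyps(1) by (intro card_mono) auto
      also have "\<dots> \<le> d" using psubset.prems \<open>k \<in> S - {l}\<close> by simp
      finally show "card {k' \<in> S - {l}. k' \<noteq> k \<and> E k k'} \<le> d" .
    qed
    have "S - {l} \<subset> S" using l(1) by blast
    from psubset.IH[OF this prem]
    obtain g :: "'a \<Rightarrow> nat" where g: "\<forall>k\<in>S - {l}. g k < 2 * d + 1"
      "\<forall>k\<in>S - {l}. \<forall>k'\<in>S - {l}. k \<noteq> k' \<longrightarrow> E k k' \<longrightarrow> g k \<noteq> g k'"
      by (elim exE conjE)
    define X where "X = {k \<in> S. k \<noteq> l \<and> E k l} \<union> {k \<in> S. k \<noteq> l \<and> E l k}"
    have "finite X" using psubset.hyps(1) by (simp add: X_def)
    have "card (g ` X) \<le> card X" using \<open>finite X\<close> by (rule card_image_le)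
    also have "\<dots> \<le> 2 * d"
      using card_Un_le[of "{k \<in> S. k \<noteq> l \<and> E k l}" "{k \<in> S. k \<noteq> l \<and> E l k}"]
        l psubset.prems[rule_format, of l] by (simp add: X_def)
    finally have "card (g ` X) < card {..<2 * d + 1}" by simp
    then have "\<not> {..<2 * d + 1} \<subseteq> g ` X"
      using \<open>finite X\<close> by (meson card_mono finite_imageI not_le)
    then obtain \<beta> where \<beta>: "\<beta> < 2 * d + 1" "\<beta> \<notin> g ` X" by auto
    show ?thesis
      using g \<beta> by (intro exI[of _ "g(l := \<beta>)"]) (auto simp: X_def)
  qed
qed

text \<open>The bound is real because it will be a product of powers of a real \<gamma>. Only the
  palette has to be finite, so infinite \<open>V\<close> are allowed.\<close>

definition chi_le :: "'v set \<Rightarrow> ('v \<Rightarrow> 'v \<Rightarrow> 'c) \<Rightarrow> 'c set \<Rightarrow> real \<Rightarrow> bool" where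
  "chi_le V c S K \<longleftrightarrow> (\<exists>f::'v \<Rightarrow> nat. finite (f ` V) \<and> real (card (f ` V)) \<le> K \<and>
     (\<forall>v\<in>V. \<forall>w\<in>V. v \<noteq> w \<longrightarrow> c v w \<in> S \<longrightarrow> f v \<noteq> f w))"

lemma chi_le_obtain:
  assumes "chi_le V c S K" and "K \<le> real r"
  obtains f :: "'v \<Rightarrow> nat" where "\<And>v. v \<in> V \<Longrightarrow> f v < r"
    "\<And>v w. v \<in> V \<Longrightarrow> w \<in> V \<Longrightarrow> v \<noteq> w \<Longrightarrow> c v w \<in> S \<Longrightarrow> f v \<noteq> f w"
proof -
  obtain f :: "'v \<Rightarrow> nat" where f: "finite (f ` V)" "real (card (f ` V)) \<le> K"
    "\<forall>v\<in>V. \<forall>w\<in>V. v \<noteq> w \<longrightarrow> c v w \<in> S \<longrightarrow> f v \<noteq> f w"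
    using assms(1) unfolding chi_le_def by blast
  obtain h where h: "bij_betw h (f ` V) {0..<card (f ` V)}"
    using ex_bij_betw_finite_nat[OF f(1)] by blast
  have "card (f ` V) \<le> r" using f(2) assms(2) by linarith
  then have "h (f v) < r" if "v \<in> V" for v
    using bij_betwE[OF h] that by fastforce
  moreover have "h (f v) \<noteq> h (f w)" if "v \<in> V" "w \<in> V" "v \<noteq> w" "c v w \<in> S" for v w
    using f(3) that bij_betw_imp_inj_on[OF h] by (auto simp: inj_on_eq_iff)
  ultimately show ?thesis by (rule that)
qed

text \<open>Frees the type of the palette: later colourings use sets, tagged sums and tuples, which
  are relabelled here by natural numbers.\<close>

lemma chi_leI:
  fixes F :: "'v \<Rightarrow> 'd"
  assumes "finite A" and "F ` V \<subseteq> A" and "real (card A) \<le> K"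
    and "\<And>v w. v \<in> V \<Longrightarrow> w \<in> V \<Longrightarrow> v \<noteq> w \<Longrightarrow> c v w \<in> S \<Longrightarrow> F v \<noteq> F w"
  shows "chi_le V c S K"
proof -
  obtain h where h: "bij_betw h A {0..<card A}"
    using ex_bij_betw_finite_nat[OF assms(1)] by blast
  have sub: "(\<lambda>v. h (F v)) ` V \<subseteq> h ` A" using assms(2) by auto
  have fin: "finite (h ` A)" using assms(1) by simp
  have "card ((\<lambda>v. h (F v)) ` V) \<le> card A"
    using card_mono[OF fin sub] card_image_le[OF assms(1), of h] by linarith
  moreover have "h (F v) \<noteq> h (F w)" if "v \<in> V" "w \<in> V" "v \<noteq> w" "c v w \<in> S" for v w
  proof -
    have "F v \<in> A" "F w \<in> A" using assms(2) that by auto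
    then show ?thesis
      using assms(4)[OF that] bij_betw_imp_inj_on[OF h] by (auto simp: inj_on_eq_iff)
  qed
  ultimately show ?thesis
    using finite_subset[OF sub fin] assms(3) unfolding chi_le_def
    by (intro exI[of _ "\<lambda>v. h (F v)"]) auto
qed

lemma chi_le_Un:
  assumes "chi_le V1 c S K1" and "chi_le V2 c S K2" and "K1 + K2 \<le> K"
  shows "chi_le (V1 \<union> V2) c S K"
proof -
  obtain f1 :: "'a \<Rightarrow> nat" where f1: "finite (f1 ` V1)" "real (card (f1 ` V1)) \<le> K1"
    "\<forall>v\<in>V1. \<forall>w\<in>V1. v \<noteq> w \<longrightarrow> c v w \<in> S \<longrightarrow> f1 v \<noteq> f1 w"
    using assms(1) unfolding chi_le_def by blast
  obtain f2 :: "'a \<Rightarrow> nat" where f2: "finite (f2 ` V2)" "real (card (f2 ` V2)) \<le> K2"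
    "\<forall>v\<in>V2. \<forall>w\<in>V2. v \<noteq> w \<longrightarrow> c v w \<in> S \<longrightarrow> f2 v \<noteq> f2 w"
    using assms(2) unfolding chi_le_def by blast
  show ?thesis
  proof (rule chi_leI[where F = "\<lambda>v. if v \<in> V1 then Inl (f1 v) else Inr (f2 v)"
        and A = "f1 ` V1 <+> f2 ` V2"])
    show "real (card (f1 ` V1 <+> f2 ` V2)) \<le> K"
      using f1(1,2) f2(1,2) assms(3) by (simp add: card_Plus)
  qed (use f1 f2 in \<open>auto split: if_splits\<close>)
qed

lemma chi_le_cong:
  assumes "chi_le V c S K" and "K \<le> K'"
    and "\<And>v w. v \<in> V \<Longrightarrow> w \<in> V \<Longrightarrow> v \<noteq> w \<Longrightarrow> c v w \<in> S' \<Longrightarrow> c v w \<in> S"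
  shows "chi_le V c S' K'"
proof -
  obtain f :: "'a \<Rightarrow> nat" where f: "finite (f ` V)" "real (card (f ` V)) \<le> K"
    "\<forall>v\<in>V. \<forall>w\<in>V. v \<noteq> w \<longrightarrow> c v w \<in> S \<longrightarrow> f v \<noteq> f w"
    using assms(1) unfolding chi_le_def by blast
  show ?thesis
    by (rule chi_leI[OF f(1) subset_refl]) (use f assms(2,3) in auto)
qed

section \<open>Mubayi's colouring\<close>

text \<open>The unordered pair of values keeps the colour symmetric. For \<open>v = w\<close> the
  \<open>LEAST\<close> is unspecified, which is harmless since \<open>chi_le\<close> inspects
  distinct vertices only.\<close>

definition mubayi :: "(nat \<Rightarrow> 'x) \<Rightarrow> (nat \<Rightarrow> 'x) \<Rightarrow> nat set \<times> 'x set" where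
  "mubayi v w = ({j. v j \<noteq> w j}, let i = LEAST j. v j \<noteq> w j in {v i, w i})"

lemma mubayi_sym: "mubayi v w = mubayi w v"
proof -
  have "(v j \<noteq> w j) = (w j \<noteq> v j)" for j by auto
  then show ?thesis unfolding mubayi_def Let_def by (simp add: insert_commute)
qed

text \<open>The leading coordinate is computed from the colour alone, so all edges of a class share
  it.\<close>

lemma mubayiD:
  assumes "v \<noteq> w" and "mubayi v w = k" and "i = (LEAST j. j \<in> fst k)"
  shows "fst k = {j. v j \<noteq> w j}" "v i \<noteq> w i" "snd k = {v i, w i}"
proof -
  show 1: "fst k = {j. v j \<noteq> w j}" using assms(2) by (auto simp: mubayi_def)
  then have i: "i = (LEAST j. v j \<noteq> w j)" using assms(3) by simp
  have "\<exists>j. v j \<noteq> w j" using assms(1) by auto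
  then show "v i \<noteq> w i" unfolding i by (rule LeastI_ex)
  show "snd k = {v i, w i}" using assms(2) unfolding i by (auto simp: mubayi_def Let_def)
qed

text \<open>Draw an arrow from \<open>k\<close> to \<open>l\<close> if the leading coordinate of
  \<open>k\<close> is among the coordinates in \<open>fst l\<close>. Sparsity bounds the out-degrees
  by \<open>B - 1\<close>, so fewer than \<open>2 * B\<close> groups suffice to leave no arrow
  inside a group. Then an edge of class \<open>k\<close> flips the indicator of \<open>k\<close> and
  no other indicator of its group.\<close>

lemma mubayi_sparse_chromatic:
  fixes V :: "(nat \<Rightarrow> 'x) set"
  assumes "finite S" and "B \<ge> 1"
    and sparse: "\<And>k. k \<in> S \<Longrightarrow> card {l \<in> S. (LEAST j. j \<in> fst k) \<in> fst l} < B"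
  shows "chi_le V mubayi S (4 ^ B)"
proof -
  define i where "i k = (LEAST j. j \<in> fst k)" for k :: "nat set \<times> 'x set"
  \<comment> \<open>Either value of the pair would do: on an edge of class \<open>k\<close>, exactly
    one endpoint has the chosen value at coordinate \<open>i k\<close>.\<close>
  define x where "x k = (SOME x. x \<in> snd k)" for k :: "nat set \<times> 'x set"
  have deg: "\<forall>k\<in>S. card {l \<in> S. l \<noteq> k \<and> i k \<in> fst l} \<le> B - 1"
  proof
    fix k assume k: "k \<in> S"
    have "card {l \<in> S. l \<noteq> k \<and> i k \<in> fst l} \<le> card {l \<in> S. i k \<in> fst l}"
      using assms(1) by (intro card_mono) auto
    with sparse[OF k] show "card {l \<in> S. l \<noteq> k \<and> i k \<in> fst l} \<le> B - 1" unfolding i_def by linarith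
  qed
  from degenerate_coloring[OF assms(1), of "\<lambda>k l. i k \<in> fst l", OF deg]
  obtain g :: "_ \<Rightarrow> nat" where g: "\<forall>k\<in>S. g k < 2 * (B - 1) + 1"
    "\<forall>k\<in>S. \<forall>l\<in>S. k \<noteq> l \<longrightarrow> i k \<in> fst l \<longrightarrow> g k \<noteq> g l"
    by (elim exE conjE)
  define T where "T \<beta> v = {k \<in> S. g k = \<beta> \<and> v (i k) = x k}" for \<beta> and v :: "nat \<Rightarrow> 'x"
  have finT: "finite (T \<beta> v)" for \<beta> v using assms(1) by (simp add: T_def)
  have parity: "odd (card (T (g k) v)) \<noteq> odd (card (T (g k) w))"
    if vw: "v \<noteq> w" and k: "mubayi v w = k" "k \<in> S" for v w k
  proof -
    note D = mubayiD[OF vw k(1) i_def[of k]]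
    have "x k \<in> snd k" unfolding x_def by (rule someI[of _ "v (i k)"]) (simp add: D(3))
    then have "x k = v (i k) \<or> x k = w (i k)" unfolding D(3) by simp
    moreover have "k \<in> T (g k) u \<longleftrightarrow> u (i k) = x k" for u using k(2) by (simp add: T_def)
    ultimately have one: "k \<in> T (g k) v \<longleftrightarrow> k \<notin> T (g k) w" using D(2) by metis
    have eq: "T (g k) v - {k} = T (g k) w - {k}"
    proof -
      \<comment> \<open>No arrow runs from \<open>l\<close> to \<open>k\<close> inside their common
        group, so \<open>v\<close> and \<open>w\<close> do not differ at the leading coordinate of
        \<open>l\<close>.\<close>
      have "v (i l) = w (i l)" if "l \<in> S" "l \<noteq> k" "g l = g k" for l
      proof -
        have "i l \<notin> fst k" using g(2) that k(2) by metis
        then show ?thesis unfolding D(1) by simp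
      qed
      then show ?thesis unfolding T_def by fastforce
    qed
    have "card (T (g k) u) = card (T (g k) u - {k}) + (if k \<in> T (g k) u then 1 else 0)" for u
      using card_Suc_Diff1[OF finT, of k "g k" u]
      by (cases "k \<in> T (g k) u") (simp_all del: card_Diff_insert)
    note this[of v] this[of w, folded eq]
    then show ?thesis using one by (cases "k \<in> T (g k) w")
      (simp_all only: if_True if_False not_True_eq_False not_False_eq_True even_Suc add_0_right
        Suc_eq_plus1[symmetric], simp_all)
  qed
  show ?thesis
  \<comment> \<open>The colour is the vector of the parities of all groups; there are
    \<open>2 ^ (2 * B) = 4 ^ B\<close> such vectors.\<close>
  proof (rule chi_leI[where A = "Pow {..<2 * B}" and F = "\<lambda>v. {\<beta>. \<beta> < 2 * B \<and> odd (card (T \<beta> v))}"])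
    show "real (card (Pow {..<2 * B})) \<le> 4 ^ B"
      by (simp add: card_Pow power_mult)
    fix v w assume "v \<noteq> w" and k: "mubayi v w \<in> S"
    with parity have "odd (card (T (g (mubayi v w)) v)) \<noteq> odd (card (T (g (mubayi v w)) w))" by blast
    moreover have "g (mubayi v w) < 2 * B" using g(1) k assms(2) by fastforce
    ultimately show "{\<beta>. \<beta> < 2 * B \<and> odd (card (T \<beta> v))} \<noteq> {\<beta>. \<beta> < 2 * B \<and> odd (card (T \<beta> w))}"
      by blast
  qed auto
qed

text \<open>Splitting at a popular leading coordinate bounds the case of p classes by the sum of the
  cases p - B and p - 1. The second condition on \<gamma> is this recursion divided by
  \<open>\<gamma> ^ (p - B)\<close>. \<open>V\<close> is generalized because both halves of the
  split recurse.\<close>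

lemma mubayi_chromatic:
  fixes V :: "(nat \<Rightarrow> 'x) set" and \<gamma> :: real
  assumes "finite S" and B: "B \<ge> 1" and \<gamma>: "\<gamma> \<ge> 1" "1 + \<gamma> ^ (B - 1) \<le> \<gamma> ^ B"
  shows "chi_le V mubayi S (4 ^ B * \<gamma> ^ card S)"
  using assms(1)
proof (induction S arbitrary: V rule: finite_psubset_induct)
  case (psubset S)
  show ?case
  proof (cases "\<forall>k\<in>S. card {l \<in> S. (LEAST j. j \<in> fst k) \<in> fst l} < B")
    case True
    then have "chi_le V mubayi S (4 ^ B)"
      using mubayi_sparse_chromatic[OF psubset.hyps(1) B] by blast
    moreover have "(4::real) ^ B * 1 \<le> 4 ^ B * \<gamma> ^ card S"
      using \<gamma>(1) by (intro mult_left_mono) auto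
    ultimately show ?thesis by (auto intro: chi_le_cong)
  next
    case False
    then obtain k where k: "k \<in> S" and big: "card {l \<in> S. (LEAST j. j \<in> fst k) \<in> fst l} \<ge> B"
      by (auto simp: not_less)
    define i where "i = (LEAST j. j \<in> fst k)"
    define x where "x = (SOME x. x \<in> snd k)"
    define A where "A = {l \<in> S. i \<in> fst l}"
    have A: "A \<subseteq> S" "finite A" "card A \<ge> B"
      using big psubset.hyps(1) by (auto simp: A_def i_def)
    have cA: "card (S - A) = card S - card A" "card A \<le> card S"
      using A psubset.hyps(1) by (auto simp: card_Diff_subset card_mono)
    have "A \<noteq> {}" using A(3) B by auto
    \<comment> \<open>Coordinate \<open>i\<close> is constant on this side, so every class of
      \<open>A\<close> loses all its edges.\<close>
    have 1: "chi_le {v \<in> V. v i = x} mubayi S (4 ^ B * \<gamma> ^ (card S - B))"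
    proof (rule chi_le_cong)
      show "chi_le {v \<in> V. v i = x} mubayi (S - A) (4 ^ B * \<gamma> ^ card (S - A))"
        using \<open>A \<noteq> {}\<close> A(1) by (intro psubset.IH) auto
      show "4 ^ B * \<gamma> ^ card (S - A) \<le> 4 ^ B * \<gamma> ^ (card S - B)"
        using \<gamma>(1) cA A(3) by (intro mult_left_mono power_increasing) auto
      show "mubayi v w \<in> S - A"
        if "v \<in> {v \<in> V. v i = x}" "w \<in> {v \<in> V. v i = x}" "v \<noteq> w" "mubayi v w \<in> S" for v w
        using that mubayiD(1)[OF that(3) refl refl] by (auto simp: A_def)
    qed
    \<comment> \<open>Every edge of class \<open>k\<close> has an endpoint with value
      \<open>x\<close> at \<open>i\<close>, so \<open>k\<close> has no edge on this side.\<close>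
    have 2: "chi_le {v \<in> V. v i \<noteq> x} mubayi S (4 ^ B * \<gamma> ^ (card S - 1))"
    proof (rule chi_le_cong)
      show "chi_le {v \<in> V. v i \<noteq> x} mubayi (S - {k}) (4 ^ B * \<gamma> ^ card (S - {k}))"
        using k by (intro psubset.IH) auto
      show "4 ^ B * \<gamma> ^ card (S - {k}) \<le> 4 ^ B * \<gamma> ^ (card S - 1)"
        using k by simp
      show "mubayi v w \<in> S - {k}"
        if "v \<in> {v \<in> V. v i \<noteq> x}" "w \<in> {v \<in> V. v i \<noteq> x}" "v \<noteq> w" "mubayi v w \<in> S" for v w
      proof -
        have "mubayi v w \<noteq> k"
        proof
          assume "mubayi v w = k"
          note D = mubayiD(3)[OF that(3) this i_def]
          have "x \<in> snd k" unfolding x_def by (rule someI[of _ "v i"]) (simp add: D)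
          with D that show False by auto
        qed
        with that(4) show ?thesis by simp
      qed
    qed
    have "card S \<ge> B" using A cA by linarith
    then have e: "card S = (card S - B) + B" "card S - 1 = (card S - B) + (B - 1)"
      using B by auto
    have "\<gamma> ^ (card S - B) + \<gamma> ^ (card S - 1) = \<gamma> ^ (card S - B) * (1 + \<gamma> ^ (B - 1))"
      by (subst e(2)) (simp add: power_add algebra_simps)
    also have "\<dots> \<le> \<gamma> ^ (card S - B) * \<gamma> ^ B"
      using \<gamma> by (intro mult_left_mono) auto
    also have "\<dots> = \<gamma> ^ card S" using e(1) by (metis power_add)
    finally have "\<gamma> ^ (card S - B) + \<gamma> ^ (card S - 1) \<le> \<gamma> ^ card S" .
    then have "4 ^ B * \<gamma> ^ (card S - B) + 4 ^ B * \<gamma> ^ (card S - 1) \<le> 4 ^ B * \<gamma> ^ card S"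
      by (simp flip: distrib_left)
    from chi_le_Un[OF 1 2 this]
    show ?thesis by (rule back_subst[of "\<lambda>U. chi_le U mubayi S _"]) auto
  qed
qed

section \<open>Tuples of vectors\<close>

definition first_diff :: "('v \<Rightarrow> 'v \<Rightarrow> 'c) \<Rightarrow> (nat \<Rightarrow> 'v) \<Rightarrow> (nat \<Rightarrow> 'v) \<Rightarrow> nat \<times> 'c" where
  "first_diff c v w = (let b = LEAST b. v b \<noteq> w b in (b, c (v b) (w b)))"

lemma first_diff_sym:
  assumes "\<And>x y. c x y = c y x"
  shows "first_diff c v w = first_diff c w v"
proof -
  have "(v j \<noteq> w j) = (w j \<noteq> v j)" for j by auto
  then show ?thesis unfolding first_diff_def Let_def using assms by simp
qed

lemma first_diff_PiE:
  assumes "v \<in> PiE {..<t} (\<lambda>_. V)" and "w \<in> PiE {..<t} (\<lambda>_. V)" and "v \<noteq> w"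
  obtains b where "b < t" "v b \<in> V" "w b \<in> V" "v b \<noteq> w b" "first_diff c v w = (b, c (v b) (w b))"
proof -
  define b where "b = (LEAST b. v b \<noteq> w b)"
  have "\<exists>b. v b \<noteq> w b" using assms(3) by auto
  then have ne: "v b \<noteq> w b" unfolding b_def by (rule LeastI_ex)
  then have "b < t" using assms(1,2) by (metis PiE_arb lessThan_iff)
  then show ?thesis using that assms(1,2) ne by (auto simp: first_diff_def Let_def b_def PiE_iff)
qed

text \<open>A class names its block, so \<open>S\<close> splits into disjoint families
  \<open>Sb b\<close>, and the product of proper colourings of the blocks is proper. The factors
  \<open>K\<close> multiply, but the sizes of the families only add up to at most
  \<open>card S\<close>: the power of \<gamma> does not grow with \<open>t\<close>.\<close>

lemma first_diff_chromatic:
  fixes V :: "'v set" and c :: "'v \<Rightarrow> 'v \<Rightarrow> 'c" and K \<gamma> :: real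
  assumes chi: "\<And>S. finite S \<Longrightarrow> chi_le V c S (K * \<gamma> ^ card S)" and "\<gamma> \<ge> 1" "K \<ge> 0" "finite S"
  shows "chi_le (PiE {..<t} (\<lambda>_. V)) (first_diff c) S (K ^ t * \<gamma> ^ card S)"
proof -
  define Sb where "Sb b = {k. (b, k) \<in> S}" for b
  have "Sb b \<subseteq> snd ` S" for b by (force simp: Sb_def)
  then have fin: "finite (Sb b)" for b using \<open>finite S\<close> by (meson finite_imageI finite_subset)
  have "\<exists>f::'v \<Rightarrow> nat. finite (f ` V) \<and> real (card (f ` V)) \<le> K * \<gamma> ^ card (Sb b) \<and>
     (\<forall>v\<in>V. \<forall>w\<in>V. v \<noteq> w \<longrightarrow> c v w \<in> Sb b \<longrightarrow> f v \<noteq> f w)" for b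
    using chi[OF fin[of b]] unfolding chi_le_def .
  then obtain f :: "nat \<Rightarrow> 'v \<Rightarrow> nat" where f: "\<And>b. finite (f b ` V)"
    "\<And>b. real (card (f b ` V)) \<le> K * \<gamma> ^ card (Sb b)"
    "\<And>b v w. v \<in> V \<Longrightarrow> w \<in> V \<Longrightarrow> v \<noteq> w \<Longrightarrow> c v w \<in> Sb b \<Longrightarrow> f b v \<noteq> f b w"
    by metis
  have "(\<Sum>b<t. card (Sb b)) = card (SIGMA b:{..<t}. Sb b)" using fin by simp
  also have "\<dots> \<le> card S" using \<open>finite S\<close> by (intro card_mono) (auto simp: Sb_def)
  finally have sum: "(\<Sum>b<t. card (Sb b)) \<le> card S" .
  show ?thesis
  proof (rule chi_leI[where A = "PiE {..<t} (\<lambda>b. f b ` V)"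
        and F = "\<lambda>v. restrict (\<lambda>b. f b (v b)) {..<t}"])
    show "finite (PiE {..<t} (\<lambda>b. f b ` V))" using f(1) by (intro finite_PiE) auto
    have "real (card (PiE {..<t} (\<lambda>b. f b ` V))) = (\<Prod>b<t. real (card (f b ` V)))"
      by (simp add: card_PiE)
    also have "\<dots> \<le> (\<Prod>b<t. K * \<gamma> ^ card (Sb b))"
      using f(2) by (intro prod_mono) auto
    also have "\<dots> = K ^ t * \<gamma> ^ (\<Sum>b<t. card (Sb b))"
      by (simp add: prod.distrib power_sum)
    also have "\<dots> \<le> K ^ t * \<gamma> ^ card S"
      using sum assms(2,3) by (intro mult_left_mono power_increasing) auto
    finally show "real (card (PiE {..<t} (\<lambda>b. f b ` V))) \<le> K ^ t * \<gamma> ^ card S" .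
    fix v w
    assume vw: "v \<in> PiE {..<t} (\<lambda>_. V)" "w \<in> PiE {..<t} (\<lambda>_. V)" "v \<noteq> w" "first_diff c v w \<in> S"
    obtain b where b: "b < t" "v b \<in> V" "w b \<in> V" "v b \<noteq> w b" "first_diff c v w = (b, c (v b) (w b))"
      using first_diff_PiE[OF vw(1-3)] .
    with vw(4) have "f b (v b) \<noteq> f b (w b)" by (intro f(3)) (auto simp: Sb_def)
    then show "restrict (\<lambda>b. f b (v b)) {..<t} \<noteq> restrict (\<lambda>b. f b (w b)) {..<t}"
      using b(1) by (auto dest: fun_cong[of _ _ b])
  qed auto
qed

section \<open>Codes with small agreement\<close>

text \<open>A Gilbert--Varshamov argument: the agreement balls around a maximal code cover everything.\<close>

lemma code_exists:
  fixes R s :: nat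
  assumes fin: "finite C" and s: "s \<le> card C" and R: "R \<ge> 1"
  obtains F where "F \<subseteq> PiE C (\<lambda>_. {..<R})"
    "\<forall>p\<in>F. \<forall>p'\<in>F. p \<noteq> p' \<longrightarrow> card {k \<in> C. p k = p' k} < s"
    "R ^ s \<le> card F * card C ^ s"
proof -
  define A where "A = PiE C (\<lambda>_. {..<R})"
  define good where "good F \<longleftrightarrow> F \<subseteq> A \<and> (\<forall>p\<in>F. \<forall>p'\<in>F. p \<noteq> p' \<longrightarrow> card {k \<in> C. p k = p' k} < s)" for F
  have finA: "finite A" unfolding A_def using fin by (intro finite_PiE) auto
  have cardA: "card A = R ^ card C" using fin by (simp add: A_def card_PiE)
  have "finite {F. good F}"
    by (rule finite_subset[of _ "Pow A"]) (use finA in \<open>auto simp: good_def\<close>)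
  moreover have "{F. good F} \<noteq> {}" by (auto simp: good_def intro: exI[of _ "{}"])
  ultimately obtain F where F: "good F" "\<And>F'. good F' \<Longrightarrow> F \<subseteq> F' \<Longrightarrow> F = F'"
    using finite_has_maximal[of "{F. good F}"] by blast
  have "F \<subseteq> A" using F(1) by (simp add: good_def)
  then have finF: "finite F" using finA finite_subset by blast
  define ball where "ball p T = {h \<in> A. \<forall>k\<in>T. h k = p k}" for p :: "'a \<Rightarrow> nat" and T
  define \<T> where "\<T> = {T. T \<subseteq> C \<and> card T = s}"
  have finT: "finite \<T>" and cardT: "card \<T> = card C choose s"
    using fin by (auto simp: \<T>_def n_subsets)
  \<comment> \<open>A word in the ball is free only on the positions outside
    \<open>T\<close>.\<close>
  have cardball: "card (ball p T) \<le> R ^ (card C - s)" if "T \<in> \<T>" for p T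
  proof -
    have T: "T \<subseteq> C" "card T = s" using that by (auto simp: \<T>_def)
    have inj: "inj_on (\<lambda>h. restrict h (C - T)) (ball p T)"
    proof (rule inj_onI)
      fix h h'
      assume h: "h \<in> ball p T" "h' \<in> ball p T" and eq: "restrict h (C - T) = restrict h' (C - T)"
      have "h k = h' k" if "k \<in> C" for k
      proof (cases "k \<in> T")
        case True
        then show ?thesis using h by (simp add: ball_def)
      next
        case False
        then show ?thesis using fun_cong[OF eq, of k] that by simp
      qed
      moreover have "h \<in> PiE C (\<lambda>_. {..<R})" "h' \<in> PiE C (\<lambda>_. {..<R})"
        using h by (auto simp: ball_def A_def)
      ultimately show "h = h'" by (metis PiE_ext)
    qed
    have "(\<lambda>h. restrict h (C - T)) ` ball p T \<subseteq> PiE (C - T) (\<lambda>_. {..<R})"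
    proof (rule image_subsetI)
      fix h assume "h \<in> ball p T"
      then have "h k \<in> {..<R}" if "k \<in> C - T" for k
        using that unfolding ball_def A_def by (auto simp: PiE_iff)
      then show "restrict h (C - T) \<in> PiE (C - T) (\<lambda>_. {..<R})" by simp
    qed
    moreover have "finite (PiE (C - T) (\<lambda>_. {..<R}))" using fin by (intro finite_PiE) auto
    ultimately have "card (ball p T) \<le> card (PiE (C - T) (\<lambda>_. {..<R}))"
      using inj by (metis card_image card_mono)
    also have "\<dots> = R ^ (card C - s)"
      using fin T by (simp add: card_PiE card_Diff_subset finite_subset)
    finally show ?thesis .
  qed
  have "A \<subseteq> (\<Union>p\<in>F. \<Union>T\<in>\<T>. ball p T)"
  proof
    fix h assume h: "h \<in> A"
    \<comment> \<open>A word of \<open>F\<close> agrees with itself on all of \<open>C\<close>,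
      which has at least \<open>s\<close> positions. Any other word cannot be added to the maximal
      \<open>F\<close>, so it agrees with some code word in at least \<open>s\<close>
      positions.\<close>
    have "\<exists>p\<in>F. s \<le> card {k \<in> C. h k = p k}"
    proof (cases "h \<in> F")
      case True
      then show ?thesis using s by (intro bexI[of _ h]) auto
    next
      case False
      then have "\<not> good (insert h F)" using F(2)[of "insert h F"] by blast
      then obtain p where "p \<in> F" "\<not> card {k \<in> C. h k = p k} < s \<or> \<not> card {k \<in> C. p k = h k} < s"
        using F(1) h unfolding good_def by blast
      moreover have "{k \<in> C. p k = h k} = {k \<in> C. h k = p k}" by auto
      ultimately show ?thesis by (auto simp: not_less)
    qed
    then obtain p where p: "p \<in> F" "s \<le> card {k \<in> C. h k = p k}" by blast
    obtain T where "T \<subseteq> {k \<in> C. h k = p k}" "card T = s"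
      using obtain_subset_with_card_n[OF p(2)] by metis
    then have "T \<in> \<T>" "h \<in> ball p T" using h by (auto simp: \<T>_def ball_def)
    with p(1) show "h \<in> (\<Union>p\<in>F. \<Union>T\<in>\<T>. ball p T)" by blast
  qed
  moreover have finball: "finite (ball p T)" for p T using finA by (simp add: ball_def)
  ultimately have "card A \<le> card (\<Union>p\<in>F. \<Union>T\<in>\<T>. ball p T)"
    using finF finT by (intro card_mono) auto
  also have "\<dots> \<le> (\<Sum>p\<in>F. card (\<Union>T\<in>\<T>. ball p T))" by (rule card_UN_le[OF finF])
  also have "\<dots> \<le> (\<Sum>p\<in>F. \<Sum>T\<in>\<T>. card (ball p T))" by (intro sum_mono card_UN_le finT)
  also have "\<dots> \<le> (\<Sum>p\<in>F. \<Sum>T\<in>\<T>. R ^ (card C - s))" by (intro sum_mono cardball)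
  also have "\<dots> = card F * (card C choose s) * R ^ (card C - s)" by (simp add: cardT)
  also have "\<dots> \<le> card F * card C ^ s * R ^ (card C - s)"
    using binomial_le_pow[OF s] by simp
  finally have "R ^ s * R ^ (card C - s) \<le> card F * card C ^ s * R ^ (card C - s)"
    using s by (simp add: cardA flip: power_add)
  then have "R ^ s \<le> card F * card C ^ s" using R by simp
  with F(1) show ?thesis by (intro that[of F]) (auto simp: good_def A_def)
qed

section \<open>From codes to grid colourings\<close>

text \<open>Rows are code words and columns are vertices. Horizontal and vertical edges can share
  the palette \<open>{..<r}\<close>, since an alternating rectangle compares only parallel
  edges.\<close>

lemma grid_coloring_exists:
  fixes V :: "'v set" and c :: "'v \<Rightarrow> 'v \<Rightarrow> 'c" and n r s R :: nat and K :: real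
  assumes V: "finite V" "n \<le> card V"
    and F: "F \<subseteq> PiE C (\<lambda>_. {..<R})" "finite F" "n \<le> card F"
    and agree: "\<And>p p'. p \<in> F \<Longrightarrow> p' \<in> F \<Longrightarrow> p \<noteq> p' \<Longrightarrow> card {k \<in> C. p k = p' k} < s"
    and c: "\<And>v w. v \<in> V \<Longrightarrow> w \<in> V \<Longrightarrow> v \<noteq> w \<Longrightarrow> c v w \<in> C" "\<And>v w. c v w = c w v"
    and chi: "\<And>S. S \<subseteq> C \<Longrightarrow> card S < s \<Longrightarrow> chi_le V c S K"
    and r: "R \<le> r" "K \<le> real r"
  shows "\<exists>col. edge_coloring n r col \<and> \<not> has_alternating_rectangle n col"
proof -
  obtain a where a: "inj_on a {1..n}" "a ` {1..n} \<subseteq> V"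
    using card_le_inj[of "{1..n}" V] V by auto
  obtain p where p: "inj_on p {1..n}" "p ` {1..n} \<subseteq> F"
    using card_le_inj[of "{1..n}" F] F by auto
  have "\<exists>f::'v \<Rightarrow> nat. S \<subseteq> C \<longrightarrow> card S < s \<longrightarrow> (\<forall>v\<in>V. f v < r) \<and>
      (\<forall>v\<in>V. \<forall>w\<in>V. v \<noteq> w \<longrightarrow> c v w \<in> S \<longrightarrow> f v \<noteq> f w)" for S
  proof (cases "S \<subseteq> C \<and> card S < s")
    case True
    then obtain f :: "'v \<Rightarrow> nat" where "\<And>v. v \<in> V \<Longrightarrow> f v < r"
      "\<And>v w. v \<in> V \<Longrightarrow> w \<in> V \<Longrightarrow> v \<noteq> w \<Longrightarrow> c v w \<in> S \<Longrightarrow> f v \<noteq> f w"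
      using chi_le_obtain[OF chi r(2)] by metis
    then show ?thesis by (intro exI[of _ f]) simp
  qed auto
  then obtain \<phi> :: "'c set \<Rightarrow> 'v \<Rightarrow> nat" where \<phi>:
    "\<And>S v. S \<subseteq> C \<Longrightarrow> card S < s \<Longrightarrow> v \<in> V \<Longrightarrow> \<phi> S v < r"
    "\<And>S v w. S \<subseteq> C \<Longrightarrow> card S < s \<Longrightarrow> v \<in> V \<Longrightarrow> w \<in> V \<Longrightarrow> v \<noteq> w \<Longrightarrow> c v w \<in> S \<Longrightarrow> \<phi> S v \<noteq> \<phi> S w"
    by metis
  define S where "S i i' = {k \<in> C. p i k = p i' k}" for i i'
  have S_sym: "S i i' = S i' i" for i i' by (auto simp: S_def)
  have S_sub: "S i i' \<subseteq> C" for i i' by (auto simp: S_def)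
  have S_card: "card (S i i') < s" if "i \<in> {1..n}" "i' \<in> {1..n}" "i \<noteq> i'" for i i'
    unfolding S_def using that p by (intro agree) (auto simp: inj_on_eq_iff)
  have aV: "a j \<in> V" if "j \<in> {1..n}" for j using a that by auto
  have a_ne: "a j \<noteq> a j'" if "j \<in> {1..n}" "j' \<in> {1..n}" "j \<noteq> j'" for j j'
    using a that by (auto simp: inj_on_eq_iff)
  have p_less: "p i k < r" if "i \<in> {1..n}" "k \<in> C" for i k
  proof -
    have "p i \<in> PiE C (\<lambda>_. {..<R})" using p(2) F(1) that(1) by blast
    then show ?thesis using that(2) r(1) by (auto simp: PiE_iff)
  qed
  define col where "col u v = (if fst u = fst v then p (fst u) (c (a (snd u)) (a (snd v)))
      else \<phi> (S (fst u) (fst v)) (a (snd u)))" for u v :: "nat \<times> nat"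
  have "edge_coloring n r col"
    unfolding edge_coloring_def
  proof (intro allI impI)
    fix u v assume e: "grid_edge n u v"
    obtain i j i' j' where uv: "u = (i, j)" "v = (i', j')" by (metis surj_pair)
    have ij: "i \<in> {1..n}" "j \<in> {1..n}" "i' \<in> {1..n}" "j' \<in> {1..n}"
      and "(i = i' \<and> j \<noteq> j') \<or> (i \<noteq> i' \<and> j = j')"
      using e by (auto simp: grid_edge_def uv)
    then consider "i = i'" "j \<noteq> j'" | "i \<noteq> i'" "j = j'" by blast
    then show "col u v = col v u \<and> col u v < r"
    proof cases
      case 1
      have "c (a j) (a j') \<in> C" using ij 1 by (intro c(1) aV a_ne)
      then show ?thesis using 1 ij c(2) p_less by (simp add: col_def uv)
    next
      case 2
      have "\<phi> (S i i') (a j) < r" using 2 ij by (intro \<phi>(1) S_sub S_card aV)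
      then show ?thesis using 2 S_sym[of i i'] by (simp add: col_def uv)
    qed
  qed
  moreover have "\<not> has_alternating_rectangle n col"
  proof
    assume "has_alternating_rectangle n col"
    then obtain i i' j j' where less: "1 \<le> i" "i < i'" "i' \<le> n" "1 \<le> j" "j < j'" "j' \<le> n"
      and eq: "col (i, j) (i', j) = col (i, j') (i', j')" "col (i, j) (i, j') = col (i', j) (i', j')"
      unfolding has_alternating_rectangle_def by blast
    from less have ij: "i \<in> {1..n}" "j \<in> {1..n}" "i' \<in> {1..n}" "j' \<in> {1..n}" "i \<noteq> i'" "j \<noteq> j'"
      by auto
    have "c (a j) (a j') \<in> C" using ij by (intro c(1) aV a_ne)
    \<comment> \<open>Equal horizontal colours mean that the two words agree on this class, and
      there the vertical colouring is proper.\<close>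
    then have "c (a j) (a j') \<in> S i i'" using eq(2) by (simp add: S_def col_def)
    then have "\<phi> (S i i') (a j) \<noteq> \<phi> (S i i') (a j')"
      using ij by (intro \<phi>(2) S_sub S_card aV a_ne)
    then show False using eq(1) ij(5) by (simp add: col_def)
  qed
  ultimately show ?thesis by blast
qed

section \<open>Lower bounds for \<open>G\<close>\<close>

text \<open>Without this, the \<open>LEAST\<close> in the definition of \<open>G\<close> could be a junk value.\<close>

lemma alternating_rectangle_exists:
  "\<exists>n. \<forall>col. edge_coloring n r col \<longrightarrow> has_alternating_rectangle n col"
proof -
  define P where "P = {(i, i'). i \<in> {1..r+1} \<and> i' \<in> {1..r+1} \<and> i < i'}"
  have "P \<subseteq> {1..r+1} \<times> {1..r+1}" by (auto simp: P_def)
  then have finP: "finite P" by (rule finite_subset) auto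
  \<comment> \<open>There are more columns than vertical patterns on the first \<open>r + 1\<close>
    rows, so two columns have the same pattern. Of the \<open>r + 1\<close> horizontal edges between
    them, two have the same colour.\<close>
  define n where "n = r + 1 + r ^ card P + 1"
  have "has_alternating_rectangle n col" if col: "edge_coloring n r col" for col
  proof -
    define colm where "colm j = restrict (\<lambda>(i, i'). col (i, j) (i', j)) P" for j
    have less: "col u v < r" if "grid_edge n u v" for u v
      using col that unfolding edge_coloring_def by blast
    have "colm j \<in> PiE P (\<lambda>_. {..<r})" if "j \<in> {1..n}" for j
    proof -
      have "col (i, j) (i', j) < r" if "(i, i') \<in> P" for i i'
        using that \<open>j \<in> {1..n}\<close> by (intro less) (auto simp: P_def grid_edge_def n_def)
      then show ?thesis by (auto simp: colm_def restrict_PiE_iff)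
    qed
    then have "colm ` {1..n} \<subseteq> PiE P (\<lambda>_. {..<r})" by blast
    then have "card (colm ` {1..n}) \<le> card (PiE P (\<lambda>_. {..<r}))"
      using finP by (intro card_mono finite_PiE) auto
    also have "\<dots> < card {1..n}" using finP by (simp add: card_PiE n_def)
    finally have "\<not> inj_on colm {1..n}" by (rule pigeonhole)
    then obtain j j' where j: "j \<in> {1..n}" "j' \<in> {1..n}" "j < j'" "colm j = colm j'"
      unfolding inj_on_def by (metis nat_neq_iff)
    define row where "row i = col (i, j) (i, j')" for i
    have "row ` {1..r+1} \<subseteq> {..<r}"
    proof (rule image_subsetI)
      fix i assume "i \<in> {1..r+1}"
      then have "grid_edge n (i, j) (i, j')" using j by (auto simp: grid_edge_def n_def)
      then show "row i \<in> {..<r}" using less by (simp add: row_def)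
    qed
    then have "card (row ` {1..r+1}) \<le> card {..<r}" by (intro card_mono) auto
    also have "\<dots> < card {1..r+1}" by simp
    finally have "\<not> inj_on row {1..r+1}" by (rule pigeonhole)
    then obtain i i' where i: "i \<in> {1..r+1}" "i' \<in> {1..r+1}" "i < i'" "row i = row i'"
      unfolding inj_on_def by (metis nat_neq_iff)
    have "col (i, j) (i', j) = col (i, j') (i', j')"
      using fun_cong[OF j(4), of "(i, i')"] i by (simp add: colm_def P_def)
    with i j show ?thesis
      unfolding has_alternating_rectangle_def row_def
      by (intro exI[of _ i] exI[of _ i'] exI[of _ j] exI[of _ j']) (auto simp: n_def)
  qed
  then show ?thesis by blast
qed

text \<open>Were \<open>G r\<close> at most \<open>n\<close>, restricting \<open>col\<close> to the
  smaller grid would give a rectangle, which also lies in the larger grid.\<close>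

lemma less_G:
  assumes "edge_coloring n r col" and "\<not> has_alternating_rectangle n col"
  shows "n < G r"
proof (rule ccontr)
  assume "\<not> n < G r"
  then have le: "G r \<le> n" by simp
  have "\<forall>col. edge_coloring (G r) r col \<longrightarrow> has_alternating_rectangle (G r) col"
    unfolding G_def by (rule LeastI_ex[OF alternating_rectangle_exists])
  moreover have "edge_coloring (G r) r col"
    using assms(1) le by (auto simp: edge_coloring_def grid_edge_def)
  ultimately have "has_alternating_rectangle (G r) col" by blast
  then have "has_alternating_rectangle n col"
    using le unfolding has_alternating_rectangle_def by (meson order_trans)
  with assms(2) show False ..
qed

section \<open>Parameters of the construction\<close>

lemma card_pair_sets_le: "card ((\<lambda>(x, y). {x, y}) ` ({..<m} \<times> {..<m::nat})) \<le> m * m"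
  using card_image_le[of "{..<m} \<times> {..<m}" "\<lambda>(x, y). {x, y}"] by simp

lemma mubayi_in:
  assumes "v \<in> PiE {..<u} (\<lambda>_. {..<m})" and "w \<in> PiE {..<u} (\<lambda>_. {..<m})" and "v \<noteq> w"
  shows "mubayi v w \<in> Pow {..<u} \<times> (\<lambda>(x, y). {x, y}) ` ({..<m} \<times> {..<m::nat})"
proof -
  define i where "i = (LEAST j. v j \<noteq> w j)"
  have sub: "j < u" if "v j \<noteq> w j" for j
    using that assms(1,2) by (metis PiE_arb lessThan_iff)
  have "\<exists>j. v j \<noteq> w j" using assms(3) by auto
  then have "v i \<noteq> w i" unfolding i_def by (rule LeastI_ex)
  then have "i < u" by (rule sub)
  then have "v i < m" "w i < m" using assms(1,2) by (auto simp: PiE_iff)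
  then have "{v i, w i} \<in> (\<lambda>(x, y). {x, y}) ` ({..<m} \<times> {..<m})"
    by (intro image_eqI[of _ _ "(v i, w i)"]) auto
  then show ?thesis using sub by (auto simp: mubayi_def Let_def i_def)
qed

text \<open>Take the \<open>t\<close>-th root of 2. With B = \<open>t * \<Lambda>\<close>,
  \<gamma>^B = 2^\<Lambda> is at least \<open>2 * t\<close>, while 1 - 1/\<gamma> is at least 1/(2t)
  by Bernoulli. Hence \<gamma>^B - \<gamma>^(B-1) = \<gamma>^B (1 - 1/\<gamma>) is at least
  1.\<close>

lemma growth_rate:
  fixes t \<Lambda> :: nat
  assumes t: "t \<ge> 1" and "2 * t \<le> 2 ^ \<Lambda>" and "\<Lambda> \<ge> 1"
  obtains \<gamma> :: real where "\<gamma> \<ge> 1" "\<gamma> ^ t = 2" "1 + \<gamma> ^ (t * \<Lambda> - 1) \<le> \<gamma> ^ (t * \<Lambda>)"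
proof -
  define \<gamma> :: real where "\<gamma> = root t 2"
  have \<gamma>: "\<gamma> \<ge> 1" "\<gamma> ^ t = 2" using t by (auto simp: \<gamma>_def)
  \<comment> \<open>Chosen so that Bernoulli's bound for \<open>(1 - \<delta>) ^ t\<close> is 1/2,
    the inverse of \<open>\<gamma> ^ t\<close>.\<close>
  define \<delta> :: real where "\<delta> = 1 / (2 * real t)"
  have \<delta>: "0 < \<delta>" "\<delta> \<le> 1 / 2" "real t * \<delta> = 1 / 2" using t by (auto simp: \<delta>_def field_simps)
  have "1 / 2 \<le> (1 - \<delta>) ^ t"
    using Bernoulli_inequality[of "- \<delta>" t] \<delta> by simp
  then have "1 \<le> ((1 - \<delta>) * \<gamma>) ^ t" by (simp add: power_mult_distrib \<gamma>(2))
  moreover have "0 \<le> (1 - \<delta>) * \<gamma>" using \<delta> \<gamma> by simp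
  ultimately have "1 \<le> (1 - \<delta>) * \<gamma>"
    using power_less_one_iff[of "(1 - \<delta>) * \<gamma>" t] t by linarith
  then have step: "\<gamma> \<ge> 1 + \<delta> * \<gamma>" by (simp add: algebra_simps)
  define B where "B = t * \<Lambda>"
  have B: "B = Suc (B - 1)" using assms(1,3) by (simp add: B_def)
  have pB: "\<gamma> ^ B = 2 ^ \<Lambda>" by (simp add: B_def power_mult \<gamma>(2))
  have "real (2 * t) \<le> real (2 ^ \<Lambda>)" using assms(2) by (simp only: of_nat_le_iff)
  then have "1 \<le> \<delta> * 2 ^ \<Lambda>" using t by (simp add: \<delta>_def field_simps)
  then have "1 + \<gamma> ^ (B - 1) \<le> \<gamma> ^ (B - 1) * (1 + \<delta> * \<gamma>)"
    using pB by (subst (asm) pB[symmetric], subst (asm) B) (simp add: algebra_simps)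
  also have "\<dots> \<le> \<gamma> ^ (B - 1) * \<gamma>" using step \<gamma>(1) by (intro mult_left_mono) auto
  also have "\<dots> = \<gamma> ^ B" by (metis B power_Suc2)
  finally show ?thesis using \<gamma> that unfolding B_def by blast
qed

text \<open>With B = \<open>t * \<Lambda>\<close> we have L = tB, so the two costs
  \<open>(4 ^ B) ^ t = 4 ^ L\<close> and \<open>\<gamma> ^ (t * L) = 2 ^ L\<close> are balanced. The
  columns are \<open>t\<close>-tuples of vectors of length \<open>L\<close> over an alphabet of size
  \<open>2 ^ L\<close>.\<close>

lemma grid_lower_bound:
  fixes t \<Lambda> r :: nat
  assumes t: "t \<ge> 1" and "2 * t \<le> 2 ^ \<Lambda>" and \<Lambda>: "\<Lambda> \<ge> 1"
    and L: "L = t ^ 2 * \<Lambda>" and r: "2 ^ (8 * L) \<le> r"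
  shows "2 ^ (t * L ^ 2) < G r"
proof -
  obtain \<gamma> :: real where \<gamma>: "\<gamma> \<ge> 1" "\<gamma> ^ t = 2" "1 + \<gamma> ^ (t * \<Lambda> - 1) \<le> \<gamma> ^ (t * \<Lambda>)"
    using growth_rate[OF assms(1-3)] .
  define V0 :: "(nat \<Rightarrow> nat) set" where "V0 = PiE {..<L} (\<lambda>_. {..<2 ^ L})"
  define V where "V = PiE {..<t} (\<lambda>_. V0)"
  define E where "E = (\<lambda>(x, y). {x, y}) ` ({..<2 ^ L} \<times> {..<2 ^ L::nat})"
  define C where "C = {..<t} \<times> (Pow {..<L} \<times> E)"
  define s where "s = t * L"
  have finV0: "finite V0" unfolding V0_def by (intro finite_PiE) auto
  then have finV: "finite V" unfolding V_def by (intro finite_PiE) auto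
  have cardV: "card V = 2 ^ (t * L ^ 2)"
    by (simp add: V_def V0_def card_PiE power2_eq_square mult.commute flip: power_mult)
  have tL: "t \<le> L" using t \<Lambda> by (simp add: L power2_eq_square)
  have L2: "L \<le> 2 ^ L" using less_exp[of L] by simp
  have finE: "finite E" by (simp add: E_def)
  have "(0, 0) \<in> {..<2 ^ L::nat} \<times> {..<2 ^ L::nat}" by simp
  then have "E \<noteq> {}" unfolding E_def by blast
  then have cardE: "1 \<le> card E" "card E \<le> 2 ^ L * 2 ^ L"
    using finE card_pair_sets_le[of "2 ^ L"] by (auto simp: E_def Suc_le_eq card_gt_0_iff)
  have finC: "finite C" using finE by (simp add: C_def)
  have cardC: "card C = t * (2 ^ L * card E)" by (simp add: C_def card_cartesian_product card_Pow)
  have "s \<le> t * (2 ^ L * 1)" using L2 by (simp add: s_def)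
  also have "\<dots> \<le> card C" unfolding cardC using cardE(1) by (intro mult_le_mono) auto
  finally have sC: "s \<le> card C" .
  \<comment> \<open>Block index, set of coordinates and each of the two values cost at most
    \<open>2 ^ L\<close> choices.\<close>
  have "card C \<le> 2 ^ L * (2 ^ L * (2 ^ L * 2 ^ L))"
    unfolding cardC using cardE(2) tL L2 by (intro mult_le_mono) linarith+
  also have "\<dots> = 2 ^ (4 * L)" by (simp flip: power_add)
  finally have Cq: "card C \<le> 2 ^ (4 * L)" .
  have "(1::nat) \<le> 2 ^ (8 * L)" by simp
  from code_exists[OF finC sC this]
  obtain F where F: "F \<subseteq> PiE C (\<lambda>_. {..<(2::nat) ^ (8 * L)})"
    "\<forall>p\<in>F. \<forall>p'\<in>F. p \<noteq> p' \<longrightarrow> card {k \<in> C. p k = p' k} < s"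
    "(2 ^ (8 * L)) ^ s \<le> card F * card C ^ s"
    .
  have finF: "finite F" using F(1) finC by (rule finite_subset[OF _ finite_PiE]) auto
  \<comment> \<open>The alphabet size is at least the square of the code length, so half of the
    exponent survives division by \<open>card C ^ s\<close>.\<close>
  have "2 ^ (4 * L * s) * 2 ^ (4 * L * s) = ((2::nat) ^ (8 * L)) ^ s"
    by (simp flip: power_add power_mult)
  also have "\<dots> \<le> card F * (2 ^ (4 * L)) ^ s"
    using F(3) Cq by (meson le_trans mult_le_mono2 power_mono zero_le)
  finally have "2 ^ (4 * L * s) \<le> card F" by (simp add: power_mult)
  moreover have "(2::nat) ^ (t * L ^ 2) \<le> 2 ^ (4 * L * s)"
    by (intro power_increasing) (auto simp: s_def power2_eq_square)
  ultimately have cardF: "2 ^ (t * L ^ 2) \<le> card F" by linarith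
  have chi: "chi_le V (first_diff mubayi) S (2 ^ (3 * L))" if "S \<subseteq> C" "card S < s" for S
  proof -
    have finS: "finite S" using that(1) finC finite_subset by blast
    have B: "1 \<le> t * \<Lambda>" using t \<Lambda> by simp
    have "chi_le V (first_diff mubayi) S ((4 ^ (t * \<Lambda>)) ^ t * \<gamma> ^ card S)"
      unfolding V_def using mubayi_chromatic[OF _ B \<gamma>(1,3)] \<gamma>(1) finS
      by (intro first_diff_chromatic) auto
    moreover have "((4::real) ^ (t * \<Lambda>)) ^ t * \<gamma> ^ card S \<le> 2 ^ (3 * L)"
    proof -
      have "((4::real) ^ (t * \<Lambda>)) ^ t = 4 ^ L"
        by (simp add: L power2_eq_square mult_ac flip: power_mult)
      moreover have "\<gamma> ^ card S \<le> \<gamma> ^ s" using \<gamma>(1) that(2) by (intro power_increasing) auto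
      moreover have "\<gamma> ^ s = 2 ^ L" by (simp add: s_def power_mult \<gamma>(2))
      moreover have "(4::real) ^ L * 2 ^ L = 2 ^ (3 * L)"
        by (simp add: power_mult flip: power_mult_distrib)
      ultimately show ?thesis
        by (metis mult_left_mono zero_le_numeral zero_le_power)
    qed
    ultimately show ?thesis by (rule chi_le_cong)
  qed
  have "(2::real) ^ (3 * L) \<le> 2 ^ (8 * L)" by (intro power_increasing) auto
  also have "\<dots> = real (2 ^ (8 * L))" by simp
  also have "\<dots> \<le> real r" using r by (simp only: of_nat_le_iff)
  finally have Kr: "(2::real) ^ (3 * L) \<le> real r" .
  have inC: "first_diff mubayi v w \<in> C" if vw: "v \<in> V" "w \<in> V" "v \<noteq> w" for v w
  proof -
    obtain b where b: "b < t" "v b \<in> V0" "w b \<in> V0" "v b \<noteq> w b"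
      "first_diff mubayi v w = (b, mubayi (v b) (w b))"
      using first_diff_PiE[OF vw[unfolded V_def]] .
    have "mubayi (v b) (w b) \<in> Pow {..<L} \<times> E"
      unfolding E_def using mubayi_in[OF b(2,3)[unfolded V0_def] b(4)] .
    with b(1,5) show ?thesis by (simp add: C_def)
  qed
  have "\<exists>col. edge_coloring (2 ^ (t * L ^ 2)) r col \<and> \<not> has_alternating_rectangle (2 ^ (t * L ^ 2)) col"
    by (rule grid_coloring_exists[OF finV _ F(1) finF cardF F(2)[rule_format] inC first_diff_sym[OF mubayi_sym] chi r Kr])
      (use cardV in auto)
  then show ?thesis using less_G by blast
qed

section \<open>Asymptotics\<close>

text \<open>Here l stands for log r. Take \<Lambda> = ceil(log l) and t = floor(sqrt(l / (8
  \<Lambda>))); then t (t^2 \<Lambda>)^2 = t^5 \<Lambda>^2 has order l^(5/2) / sqrt(log l).\<close>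

lemma parameter_choice:
  fixes l :: real
  assumes "log 2 l \<ge> 1" and "8 * (log 2 l + 1) \<le> l"
  obtains t \<Lambda> :: nat where "t \<ge> 1" "\<Lambda> \<ge> 1" "2 * t \<le> 2 ^ \<Lambda>" "real (8 * (t ^ 2 * \<Lambda>)) \<le> l"
    "1 / 8192 * l powr (5/2) / sqrt (log 2 l) \<le> real (t * (t ^ 2 * \<Lambda>) ^ 2)"
proof -
  define y where "y = log 2 l"
  have y: "y \<ge> 1" and yl: "8 * y + 8 \<le> l" using assms by (simp_all add: y_def)
  have l: "l > 0" using y yl by linarith
  define \<Lambda> where "\<Lambda> = nat \<lceil>y\<rceil>"
  have \<Lambda>: "y \<le> real \<Lambda>" "real \<Lambda> \<le> y + 1" using y unfolding \<Lambda>_def by linarith+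
  define x where "x = sqrt (l / (8 * real \<Lambda>))"
  have \<Lambda>1: "real \<Lambda> \<ge> 1" using \<Lambda> y by linarith
  have "8 * real \<Lambda> \<le> l" using \<Lambda> yl by linarith
  then have x1: "x \<ge> 1" using \<Lambda>1 by (simp add: x_def)
  have xx: "x ^ 2 = l / (8 * real \<Lambda>)" using l by (simp add: x_def)
  define t where "t = nat \<lfloor>x\<rfloor>"
  have t: "real t \<le> x" "x < real t + 1" using x1 unfolding t_def by linarith+
  have t1: "t \<ge> 1" using t x1 unfolding t_def by linarith
  have "real t ^ 2 * real \<Lambda> \<le> x ^ 2 * real \<Lambda>"
    using t by (intro mult_right_mono power_mono) auto
  also have "\<dots> = l / 8" using \<Lambda>1 by (simp add: xx)
  finally have le: "real (8 * (t ^ 2 * \<Lambda>)) \<le> l" by simp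
  have "2 * real t \<le> l"
  proof -
    have "x * 1 \<le> x * x" using x1 by (intro mult_left_mono) auto
    then have "x \<le> l / (8 * real \<Lambda>)" using xx by (simp add: power2_eq_square)
    also have "\<dots> \<le> l / 8" using \<Lambda>1 l by (intro divide_left_mono) auto
    finally show ?thesis using t(1) l by linarith
  qed
  also have "l = 2 powr y" using l by (simp add: y_def)
  also have "\<dots> \<le> 2 powr real \<Lambda>" using \<Lambda>(1) by simp
  also have "\<dots> = real (2 ^ \<Lambda>)" by (simp add: powr_realpow)
  finally have "real (2 * t) \<le> real (2 ^ \<Lambda>)" by simp
  then have t2: "2 * t \<le> 2 ^ \<Lambda>" by (simp only: of_nat_le_iff)
  define z where "z = sqrt (8 * real \<Lambda>)"
  have z: "z > 0" "z ^ 2 = 8 * real \<Lambda>" using \<Lambda>1 by (auto simp: z_def)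
  have z5: "z ^ 5 = 64 * real \<Lambda> ^ 2 * z"
  proof -
    have "z ^ 5 = (z ^ 2) ^ 2 * z" by (simp add: power_numeral_reduce)
    then show ?thesis unfolding z(2) by (simp add: power_mult_distrib)
  qed
  have l5: "l powr (5/2) = sqrt l ^ 5"
    using l by (simp add: powr_half_sqrt[symmetric] powr_power)
  have "z \<le> sqrt (16 * y)" unfolding z_def using \<Lambda>(2) y by (intro real_sqrt_le_mono) linarith
  also have "\<dots> = 4 * sqrt y" by (simp add: real_sqrt_mult)
  finally have zy: "z \<le> 4 * sqrt y" .
  \<comment> \<open>The constant is 8192 = 4 * 64 * 32: 4 from \<open>zy\<close>, 64 from
    \<open>z5\<close>, and 32 = 2^5 from replacing \<open>t\<close> by \<open>x / 2\<close>.\<close>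
  have "1 / 8192 * l powr (5/2) / sqrt y = sqrt l ^ 5 / (2048 * (4 * sqrt y))"
    by (simp add: l5)
  also have "\<dots> \<le> sqrt l ^ 5 / (2048 * z)"
    using zy z(1) l y by (intro divide_left_mono) auto
  also have "\<dots> = (x / 2) ^ 5 * real \<Lambda> ^ 2"
  proof -
    have "x = sqrt l / z" by (simp add: x_def z_def real_sqrt_divide)
    then show ?thesis using z(1) \<Lambda>1 by (simp add: power_divide z5)
  qed
  also have "\<dots> \<le> real t ^ 5 * real \<Lambda> ^ 2"
  proof -
    \<comment> \<open>Rounding down loses at most a factor 2, since x < t + 1 and t + 1 is at most
      2t.\<close>
    have "1 \<le> real t" using t1 by simp
    then have "x / 2 \<le> real t" using t(2) by linarith
    then show ?thesis using x1 by (intro mult_right_mono power_mono) auto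
  qed
  also have "\<dots> = real (t * (t ^ 2 * \<Lambda>) ^ 2)"
    by (simp add: power_mult_distrib power_numeral_reduce)
  finally have "1 / 8192 * l powr (5/2) / sqrt (log 2 l) \<le> real (t * (t ^ 2 * \<Lambda>) ^ 2)"
    unfolding y_def .
  moreover have "\<Lambda> \<ge> 1" using \<Lambda>1 by simp
  ultimately show ?thesis using that t1 t2 le by blast
qed

theorem theorem1p2:
  shows "\<exists>c::real. c > 0 \<and> (\<forall>\<^sub>F r in sequentially.
     real (G r) > 2 powr (c * (log 2 (real r)) powr (5/2) / sqrt (log 2 (log 2 (real r)))))"
proof (intro exI[of _ "1 / 8192"] conjI)
  \<comment> \<open>These two eventual bounds are the hypotheses of \<open>parameter_choice\<close>
    for \<open>l = log 2 (real r)\<close>.\<close>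
  have "\<forall>\<^sub>F r :: nat in sequentially. log 2 (log 2 (real r)) \<ge> 1"
    by real_asymp
  moreover have "\<forall>\<^sub>F r :: nat in sequentially. 8 * (log 2 (log 2 (real r)) + 1) \<le> log 2 (real r)"
    by real_asymp
  ultimately show "\<forall>\<^sub>F r in sequentially. real (G r) >
      2 powr (1 / 8192 * (log 2 (real r)) powr (5/2) / sqrt (log 2 (log 2 (real r))))"
    using eventually_gt_at_top[of 0]
  proof eventually_elim
    case (elim r)
    obtain t \<Lambda> :: nat where par: "t \<ge> 1" "\<Lambda> \<ge> 1" "2 * t \<le> 2 ^ \<Lambda>"
      "real (8 * (t ^ 2 * \<Lambda>)) \<le> log 2 (real r)"
      "1 / 8192 * log 2 (real r) powr (5/2) / sqrt (log 2 (log 2 (real r))) \<le> real (t * (t ^ 2 * \<Lambda>) ^ 2)"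
      using parameter_choice[OF elim(1,2)] .
    have "2 powr real (8 * (t ^ 2 * \<Lambda>)) \<le> real r"
      using par(4) elim(3) by (simp only: le_log_iff of_nat_0_less_iff one_less_numeral_iff semiring_norm)
    then have "real (2 ^ (8 * (t ^ 2 * \<Lambda>))) \<le> real r"
      by (simp add: powr_realpow[symmetric])
    then have "2 ^ (8 * (t ^ 2 * \<Lambda>)) \<le> r" by (simp only: of_nat_le_iff)
    from grid_lower_bound[OF par(1,3,2) refl this]
    have "real (2 ^ (t * (t ^ 2 * \<Lambda>) ^ 2)) < real (G r)" by (simp only: of_nat_less_iff)
    moreover have "real (2 ^ (t * (t ^ 2 * \<Lambda>) ^ 2)) = 2 powr real (t * (t ^ 2 * \<Lambda>) ^ 2)"
      by (simp only: powr_realpow zero_less_numeral of_nat_power of_nat_numeral)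
    moreover have "2 powr (1 / 8192 * log 2 (real r) powr (5/2) / sqrt (log 2 (log 2 (real r))))
        \<le> 2 powr real (t * (t ^ 2 * \<Lambda>) ^ 2)"
      using par(5) by (intro powr_mono) auto
    ultimately show ?case by linarith
  qed
qed simp

end
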